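(* Let $T$ be an $n+n$ symbic tree, and let $O$ be a chosen vertex of $T$ fixed by the color-swapping involution. For each node $v$ of $T$ (nodes being taken up to the involution), let $P_v$ be the configuration of points $\mathbf e_i+\mathbf e_j\in\mathbb{Z}^n$ such that the path from $O$ to leaf $i$ and the path from $O$ to leaf $j'$ diverge at the node $v$. Then the matroid associated with $T$ is given by the affine independences in the Cayley embedding of the configurations $P_v$: a set $S\subseteq\{(i,j):1\le i\le j\le n\}$ is independent in the matroid of $T$ if and only if the corresponding points of the Cayley embedding are affinely independent, where $(i,j)$ corresponds to the copy of $\mathbf e_i+\mathbf e_j$ in $P_v$ for the unique $v$ (up to the involution) with $\mathbf e_i+\mathbf e_j\in P_v$.
   Context: **Symbic trees.** A split of a tree is a partition of the leaf labels obtained by removing an internal (non-leaf) edge. An $n+n$ symbic tree is a metric tree on leaves labelled $1,\dots,n,1',\dots,n'$ (unprimed and primed labels are two colors; no unlabelled vertices of degree 2; lengths of leaf edges disregarded) such that (1) each split contains both colors on both sides; (2) internal edges have positive lengths; (3) the metric tree is symmetric with respect to the involution swapping $i$ and $i'$ for all $i$; (4) the fixed points of the involution form a path (possibly a single point; if it is the midpoint of an edge, it is regarded as a vertex of degree 2). Nodes are the non-leaf vertices. Two nodes exchanged by the involution are identified (they carry the same parameter, the distance from $O$). **Matroid of $T$.** Let $\mathcal T$ be the combinatorial type of $T$ (forgetting lengths) and let $C_{\mathcal T}$ be the cone of symmetric real $n\times n$ matrices of symmetric tropical rank $2$ whose symbic tree has type $\mathcal T$. Explicitly, $C_{\mathcal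 T}=\{A_{T'}\mid T'\text{ a symbic tree of type }\mathcal T\}+L$, where $L=\{(X_i+X_j)_{i,j}\mid X\in\mathbb{R}^n\}$ and $A_{T'}$ is the symmetric matrix whose $(i,j)$ entry is the distance in $T'$ from $O$ to the vertex where the path from $O$ to leaf $i$ and the path from $O$ to leaf $j'$ diverge. The matroid associated with $T$ is the matroid on $E=\{(i,j):1\le i\le j\le n\}$ in which $S$ is independent iff the projection of the linear span of $C_{\mathcal T}$ (in $\mathbb{R}^E$) to $\mathbb{R}^S$ is surjective. **Cayley embedding.** For point configurations $P_0,P_1,\dots,P_r\subset\mathbb{Z}^n$, the Cayley embedding is the configuration $(P_0\times\{0\})\cup(P_1\times\{\mathbf e_1\})\cup\dots\cup(P_r\times\{\mathbf e_r\})\subset\mathbb{Z}^n\times\mathbb{Z}^r$. Here $P_0=P_O$ is the configuration of the node $O$ and $P_1,\dots,P_r$ are those of the remaining nodes up to the involution. *)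

theory Defs
  imports
    "Graph_Theory.Graph_Theory"
    "HOL-Library.Sublist"
    "HOL-Analysis.Analysis"
    "HOL-Analysis.Finite_Function_Topology"
begin

section \<open>Leaf-labelled trees with an involution\<close>

datatype 'n leaf_label = Unprimed 'n | Primed 'n

fun swap_colour :: "'n leaf_label \<Rightarrow> 'n leaf_label" where
  "swap_colour (Unprimed i) = Primed i"
| "swap_colour (Primed i) = Unprimed i"

text \<open>
  Undirected graphs are symmetric digraphs without loops and parallel arcs (locale
  \<open>pair_graph\<close>), every edge being represented by its two arcs. The leaves of an \<open>n+n\<close> tree are
  labelled by a finite type \<open>'n\<close> with \<open>n\<close> elements, in two colours. The involution of the tree
  is kept as a field; the values of the fields outside the tree are irrelevant.
\<close>

record ('v, 'n) swap_tree =
  tgraph :: "'v pair_pre_digraph"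
  leaf :: "'n leaf_label \<Rightarrow> 'v"
  invol :: "'v \<Rightarrow> 'v"

record ('v, 'n) metric_swap_tree = "('v, 'n) swap_tree" +
  edge_length :: "'v \<times> 'v \<Rightarrow> real"

definition combinatorial_type :: "('v, 'n) metric_swap_tree \<Rightarrow> ('v, 'n) swap_tree" where
  "combinatorial_type T = swap_tree.truncate T"

text \<open>
  \<open>Digraph_Component.tree\<close> is not suitable here: it excludes the 2-cycle formed by
  the two arcs of an undirected edge.
\<close>

definition is_tree :: "'v pair_pre_digraph \<Rightarrow> bool" where
  "is_tree G \<longleftrightarrow> pair_graph G \<and> pverts G \<noteq> {} \<and>
     (\<forall>u\<in>pverts G. \<forall>v\<in>pverts G. \<exists>!p. pre_digraph.apath (with_proj G) u p v)"

definition nodes :: "('v, 'n, 'm) swap_tree_scheme \<Rightarrow> 'v set" where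
  "nodes T = pverts (tgraph T) - range (leaf T)"

definition internal_arcs :: "('v, 'n, 'm) swap_tree_scheme \<Rightarrow> ('v \<times> 'v) set" where
  "internal_arcs T = parcs (tgraph T) \<inter> (nodes T \<times> nodes T)"

definition fixed_verts :: "('v, 'n, 'm) swap_tree_scheme \<Rightarrow> 'v set" where
  "fixed_verts T = {v \<in> pverts (tgraph T). invol T v = v}"

definition del_edge :: "'v pair_pre_digraph \<Rightarrow> 'v \<Rightarrow> 'v \<Rightarrow> 'v pair_pre_digraph" where
  "del_edge G u v = G\<lparr>parcs := parcs G - {(u, v), (v, u)}\<rparr>"

text \<open>The labels that stay connected to \<open>u\<close> when the edge between \<open>u\<close> and \<open>v\<close> is removed:\<close>

definition side :: "('v, 'n, 'm) swap_tree_scheme \<Rightarrow> 'v \<Rightarrow> 'v \<Rightarrow> 'n leaf_label set" where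
  "side T u v = {l. reachable (with_proj (del_edge (tgraph T) u v)) u (leaf T l)}"

definition splits :: "('v, 'n, 'm) swap_tree_scheme \<Rightarrow> 'n leaf_label set set set" where
  "splits T = {{side T u v, side T v u} | u v. (u, v) \<in> internal_arcs T}"


section \<open>Symbic trees\<close>

text \<open>
  If the involution of the metric tree flips an edge, then its only fixed point is the midpoint
  of that edge, which is a vertex of degree 2 here. All other vertices of degree 2 are
  excluded: a vertex of degree 2 that is the only fixed vertex has its two neighbours
  exchanged by the involution. Conversely, as the path of fixed vertices in the last condition is
  nonempty, no edge is flipped, so that the fixed points of the metric tree are exactly the points
  of the subtree spanned by the fixed vertices.
\<close>

definition symbic_tree :: "('v, 'n) metric_swap_tree \<Rightarrow> bool" where
  "symbic_tree T \<longleftrightarrow>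
     is_tree (tgraph T) \<and>
     \<comment> \<open>the leaves are labelled bijectively, and there are no further vertices of degree 2\<close>
     inj (leaf T) \<and>
     range (leaf T) = {v \<in> pverts (tgraph T). out_degree (with_proj (tgraph T)) v = 1} \<and>
     (\<forall>v\<in>pverts (tgraph T).
        out_degree (with_proj (tgraph T)) v = 2 \<longrightarrow> fixed_verts T = {v}) \<and>
     \<comment> \<open>\<open>invol T\<close> is the involutive tree automorphism exchanging the colours\<close>
     (\<forall>v\<in>pverts (tgraph T). invol T v \<in> pverts (tgraph T) \<and> invol T (invol T v) = v) \<and>
     (\<forall>(u, v)\<in>parcs (tgraph T). (invol T u, invol T v) \<in> parcs (tgraph T)) \<and>
     (\<forall>l. invol T (leaf T l) = leaf T (swap_colour l)) \<and>
     \<comment> \<open>every split has both colours on both sides\<close>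
     (\<forall>\<sigma>\<in>splits T. \<forall>B\<in>\<sigma>. (\<exists>i. Unprimed i \<in> B) \<and> (\<exists>j. Primed j \<in> B)) \<and>
     \<comment> \<open>lengths of internal edges are positive and symmetric; those of leaf edges are arbitrary\<close>
     (\<forall>(u, v)\<in>internal_arcs T. edge_length T (u, v) > 0 \<and>
        edge_length T (v, u) = edge_length T (u, v) \<and>
        edge_length T (invol T u, invol T v) = edge_length T (u, v)) \<and>
     \<comment> \<open>the fixed points form a path\<close>
     (\<exists>u p v. pre_digraph.apath (with_proj (tgraph T)) u p v \<and>
        set (pawalk_verts u p) = fixed_verts T)"


section \<open>The matroid of a symbic tree\<close>

definition tree_path :: "('v, 'n, 'm) swap_tree_scheme \<Rightarrow> 'v \<Rightarrow> 'v \<Rightarrow> ('v \<times> 'v) list" where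
  "tree_path T u v = (THE p. pre_digraph.apath (with_proj (tgraph T)) u p v)"

definition tree_dist :: "('v, 'n) metric_swap_tree \<Rightarrow> 'v \<Rightarrow> 'v \<Rightarrow> real" where
  "tree_dist T u v = (\<Sum>e\<leftarrow>tree_path T u v. edge_length T e)"

text \<open>
  The vertex where the paths from the origin \<open>org\<close> to the leaf \<open>i\<close> and to the leaf \<open>j'\<close> diverge,
  i.e. their last common vertex:
\<close>

definition divergence :: "('v, 'n, 'm) swap_tree_scheme \<Rightarrow> 'v \<Rightarrow> 'n \<Rightarrow> 'n \<Rightarrow> 'v" where
  "divergence T org i j = last (longest_common_prefix
     (pawalk_verts org (tree_path T org (leaf T (Unprimed i))))
     (pawalk_verts org (tree_path T org (leaf T (Primed j)))))"

definition tree_matrix :: "('v, 'n::finite) metric_swap_tree \<Rightarrow> 'v \<Rightarrow> real^'n^'n" where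
  "tree_matrix T org = (\<chi> i j. tree_dist T org (divergence T org i j))"

definition lineality :: "(real^'n::finite^'n) set" where
  "lineality = {(\<chi> i j. X $ i + X $ j) | X :: real^'n. True}"

definition type_cone :: "('v, 'n::finite) metric_swap_tree \<Rightarrow> 'v \<Rightarrow> (real^'n^'n) set" where
  "type_cone T org = {tree_matrix T' org + B | T' B.
     symbic_tree T' \<and> combinatorial_type T' = combinatorial_type T \<and> B \<in> lineality}"

definition ground_set :: "('n::linorder \<times> 'n) set" where
  "ground_set = {(i, j). i \<le> j}"

definition coord_proj :: "('n \<times> 'n) set \<Rightarrow> real^'n::finite^'n \<Rightarrow> ('n \<times> 'n \<Rightarrow> real)" where
  "coord_proj S A = restrict (\<lambda>(i, j). A $ i $ j) S"

text \<open>
  The matrices in \<open>type_cone\<close> are symmetric, so for \<open>S \<subseteq> ground_set\<close> it makes no difference that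
  they are not first restricted to the entries in \<open>ground_set\<close>.
\<close>

definition matroid_indep ::
    "('v, 'n::{finite,linorder}) metric_swap_tree \<Rightarrow> 'v \<Rightarrow> ('n \<times> 'n) set \<Rightarrow> bool" where
  "matroid_indep T org S \<longleftrightarrow>
     S \<subseteq> ground_set \<and> coord_proj S ` span (type_cone T org) = (S \<rightarrow>\<^sub>E (UNIV :: real set))"


section \<open>The Cayley embedding\<close>

text \<open>
  Vectors in the second factor of the Cayley embedding are finitely supported functions on an
  index type \<open>'k\<close>; only the coordinates in \<open>K - {k0}\<close>, where \<open>k0\<close> is the index playing the
  role of \<open>0\<close>, are ever nonzero.
\<close>

definition cayley ::
    "('k \<Rightarrow> (int^'n::finite) set) \<Rightarrow> 'k \<Rightarrow> 'k set \<Rightarrow> ((int^'n) \<times> ('k \<Rightarrow>\<^sub>0 int)) set" where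
  "cayley P k0 K = (P k0 \<times> {0}) \<union> (\<Union>k\<in>K - {k0}. P k \<times> {Poly_Mapping.single k 1})"

definition real_point ::
    "(int^'n::finite) \<times> ('k \<Rightarrow>\<^sub>0 int) \<Rightarrow> (real^'n) \<times> ('k \<Rightarrow>\<^sub>0 real)" where
  "real_point p = ((\<chi> i. real_of_int (fst p $ i)), Poly_Mapping.map real_of_int (snd p))"

definition edge_vec :: "'n \<Rightarrow> 'n \<Rightarrow> int^'n::finite" where
  "edge_vec i j = axis i 1 + axis j 1"

definition node_config :: "('v, 'n::finite) metric_swap_tree \<Rightarrow> 'v \<Rightarrow> 'v \<Rightarrow> (int^'n) set" where
  "node_config T org v = {edge_vec i j | i j. divergence T org i j = v}"

definition node_classes :: "('v, 'n) metric_swap_tree \<Rightarrow> 'v set set" where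
  "node_classes T = {{v, invol T v} | v. v \<in> nodes T}"

text \<open>
  If \<open>org\<close> is fixed by the involution, then \<open>node_config T org\<close> is constant on node classes:
  exchanging \<open>i\<close> and \<open>j\<close> replaces the node of divergence by its image under the involution.
\<close>

definition class_config ::
    "('v, 'n::finite) metric_swap_tree \<Rightarrow> 'v \<Rightarrow> 'v set \<Rightarrow> (int^'n) set" where
  "class_config T org c = (\<Union>v\<in>c. node_config T org v)"

definition tree_cayley ::
    "('v, 'n::finite) metric_swap_tree \<Rightarrow> 'v \<Rightarrow> ((int^'n) \<times> ('v set \<Rightarrow>\<^sub>0 int)) set" where
  "tree_cayley T org = cayley (class_config T org) {org} (node_classes T)"

definition cayley_point ::
    "('v, 'n::finite) metric_swap_tree \<Rightarrow> 'v \<Rightarrow> 'n \<times> 'n \<Rightarrow> (int^'n) \<times> ('v set \<Rightarrow>\<^sub>0 int)" where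
  "cayley_point T org = (\<lambda>(i, j). THE p. p \<in> tree_cayley T org \<and> fst p = edge_vec i j)"

end

theory Submission
  imports Defs
begin

text \<open>
  The distances of the nodes from the root can be prescribed freely, subject to invariance under the
  involution and to monotonicity along the tree. Hence the span of the type cone consists of the
  matrices with entries \<open>h (divergence i j) + X\<^sub>i + X\<^sub>j\<close>, where \<open>h\<close> is an arbitrary function on the
  node classes that vanishes at the root. These entries are the values of the linear functional
  \<open>(X, h)\<close> at the points of the Cayley embedding. By duality, \<open>S\<close> is independent iff the points
  belonging to \<open>S\<close> are linearly independent, and linear independence is the same as affine
  independence because the points lie on the hyperplane where the first \<open>n\<close> coordinates sum to 2.
\<close>

section \<open>Common prefixes, and sums of two unit vectors\<close>

lemma longest_common_prefix_commute:
  "longest_common_prefix xs ys = longest_common_prefix ys xs"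
  by (induction xs ys rule: longest_common_prefix.induct) auto

lemma longest_common_prefix_map:
  assumes "inj_on f (set xs \<union> set ys)"
  shows "longest_common_prefix (map f xs) (map f ys) = map f (longest_common_prefix xs ys)"
  using assms
proof (induction xs ys rule: longest_common_prefix.induct)
  case (1 x xs y ys)
  have "inj_on f (set xs \<union> set ys)"
    using "1.prems" by (rule inj_on_subset) auto
  moreover have "f x = f y \<longleftrightarrow> x = y"
    using inj_on_eq_iff[OF "1.prems"] by simp
  ultimately show ?case using "1.IH" by auto
qed auto

lemma pawalk_verts_map:
  "pawalk_verts (f u) (map (map_prod f f) p) = map f (pawalk_verts u p)"
  by (induction p arbitrary: u) auto

lemma edge_vec_eq_iff:
  "edge_vec i j = edge_vec k l \<longleftrightarrow> (i = k \<and> j = l) \<or> (i = l \<and> j = k)"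
proof
  assume eq: "edge_vec i j = edge_vec k l"
  have "edge_vec i j $ m = edge_vec k l $ m" for m
    by (simp add: eq)
  \<comment> \<open>Both vectors vanish at all coordinates other than these four; a value 2 at a
    coordinate signals a repeated index.\<close>
  from this[of i] this[of j] this[of k] this[of l]
  show "(i = k \<and> j = l) \<or> (i = l \<and> j = k)"
    by (auto simp: edge_vec_def axis_def split: if_splits)
qed (auto simp: edge_vec_def add.commute)

section \<open>The combinatorics of a rooted symbic tree\<close>

lemma same_combinatorial_type:
  assumes "combinatorial_type T' = combinatorial_type T"
  shows "tgraph T' = tgraph T" "leaf T' = leaf T" "invol T' = invol T"
  using assms by (auto simp: combinatorial_type_def swap_tree.defs)

text \<open>A locale, because its facts are needed again for the other trees of the same
  combinatorial type.\<close>

locale rooted_symbic_tree =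
  fixes T :: "('v, 'n::finite) metric_swap_tree" and org :: 'v
  assumes symbic: "symbic_tree T"
    and org_vert: "org \<in> pverts (tgraph T)"
    and invol_org: "invol T org = org"

sublocale rooted_symbic_tree \<subseteq> pair_graph "tgraph T"
  using symbic by (simp add: symbic_tree_def is_tree_def)

context rooted_symbic_tree
begin

abbreviation invol_arc :: "'v \<times> 'v \<Rightarrow> 'v \<times> 'v" where
  "invol_arc \<equiv> map_prod (invol T) (invol T)"

abbreviation path_to :: "'v \<Rightarrow> ('v \<times> 'v) list" where
  "path_to \<equiv> tree_path T org"

lemma ex1_apath:
  "u \<in> pverts (tgraph T) \<Longrightarrow> v \<in> pverts (tgraph T) \<Longrightarrow> \<exists>!p. apath u p v"
  using symbic by (simp add: symbic_tree_def is_tree_def)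

lemma invol_vert: "v \<in> pverts (tgraph T) \<Longrightarrow> invol T v \<in> pverts (tgraph T)"
  using symbic by (simp add: symbic_tree_def)

lemma invol_invol: "v \<in> pverts (tgraph T) \<Longrightarrow> invol T (invol T v) = v"
  using symbic by (simp add: symbic_tree_def)

lemma invol_leaf: "invol T (leaf T l) = leaf T (swap_colour l)"
  using symbic by (simp add: symbic_tree_def)

lemma inj_leaf: "inj (leaf T)"
  using symbic by (simp add: symbic_tree_def)

lemma range_leaf: "range (leaf T) =
    {v \<in> pverts (tgraph T). out_degree (with_proj (tgraph T)) v = 1}"
  using symbic unfolding symbic_tree_def by (elim conjE)

lemma invol_arc_in_arcs: "e \<in> parcs (tgraph T) \<Longrightarrow> invol_arc e \<in> parcs (tgraph T)"
  using symbic by (cases e) (auto simp: symbic_tree_def)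

lemma internal_arc_length:
  assumes "(u, v) \<in> internal_arcs T"
  shows "edge_length T (invol T u, invol T v) = edge_length T (u, v)"
  using symbic assms by (auto simp: symbic_tree_def)

lemma leaf_vert: "leaf T l \<in> pverts (tgraph T)"
  using range_leaf by auto

lemma node_vert: "v \<in> nodes T \<Longrightarrow> v \<in> pverts (tgraph T)"
  by (simp add: nodes_def)

lemma inj_on_invol: "inj_on (invol T) (pverts (tgraph T))"
  by (metis inj_onI invol_invol)

lemma org_node: "org \<in> nodes T"
proof -
  \<comment> \<open>The involution changes the colour of a label, so no leaf is fixed.\<close>
  have "leaf T l \<noteq> org" for l
  proof
    assume "leaf T l = org"
    then have "leaf T (swap_colour l) = leaf T l"
      using invol_leaf[of l] invol_org by simp
    then have "swap_colour l = l"
      using inj_leaf by (simp add: inj_eq)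
    then show False by (cases l) auto
  qed
  then show ?thesis
    using org_vert by (auto simp: nodes_def)
qed

section \<open>Unique paths and their images under the involution\<close>

lemma tree_path_eqI:
  assumes "apath u p v"
  shows "tree_path T u v = p"
proof -
  have "\<exists>!p. apath u p v"
    using assms by (intro ex1_apath) (auto simp: apath_def)
  then show ?thesis
    unfolding tree_path_def using assms by (rule the1_equality)
qed

lemma apath_path_to: "v \<in> pverts (tgraph T) \<Longrightarrow> apath org (path_to v) v"
  using ex1_apath[OF org_vert] tree_path_eqI by metis

lemma path_to_org: "path_to org = []"
  by (rule tree_path_eqI) (simp add: apath_Nil_iff org_vert)

text \<open>The involution preserves arcs, and its injectivity on the vertices keeps the vertices of
  a path distinct.\<close>

lemma apath_invol:
  assumes "apath u p v"
  shows "apath (invol T u) (map invol_arc p) (invol T v)"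
  using assms
proof (induction p arbitrary: u)
  case Nil
  then show ?case by (auto simp: apath_Nil_iff invol_vert)
next
  case (Cons e p)
  have e: "e \<in> parcs (tgraph T)" "fst e = u" and p: "apath (snd e) p v"
    and u: "u \<notin> set (pawalk_verts (snd e) p)"
    using Cons.prems by (auto simp: apath_Cons_iff)
  have "u \<in> pverts (tgraph T)" "set (pawalk_verts (snd e) p) \<subseteq> pverts (tgraph T)"
    using Cons.prems p by (auto simp: apath_def)
  then have "invol T u \<notin> invol T ` set (pawalk_verts (snd e) p)"
    using u inj_on_invol by (auto dest: inj_onD)
  moreover have "apath (invol T (snd e)) (map invol_arc p) (invol T v)"
    using Cons.IH p by blast
  ultimately show ?case
    using invol_arc_in_arcs[OF e(1)] e(2)
    by (simp add: apath_Cons_iff pawalk_verts_map)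
qed

lemma path_to_invol:
  assumes "v \<in> pverts (tgraph T)"
  shows "path_to (invol T v) = map invol_arc (path_to v)"
  using apath_invol[OF apath_path_to[OF assms]] by (simp add: invol_org tree_path_eqI)

section \<open>Leaves as ends of paths, and induction outwards from the root\<close>

lemma leaf_neighbour_unique:
  assumes "(leaf T l, a) \<in> parcs (tgraph T)" "(leaf T l, b) \<in> parcs (tgraph T)"
  shows "a = b"
proof -
  have "card (out_arcs (with_proj (tgraph T)) (leaf T l)) = 1"
    using range_leaf by (auto simp: out_degree_def)
  then obtain e where "out_arcs (with_proj (tgraph T)) (leaf T l) = {e}"
    by (auto simp: card_1_singleton_iff)
  moreover have "(leaf T l, a) \<in> out_arcs (with_proj (tgraph T)) (leaf T l)"
    "(leaf T l, b) \<in> out_arcs (with_proj (tgraph T)) (leaf T l)"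
    using assms by (auto simp: out_arcs_def)
  ultimately show ?thesis by auto
qed

text \<open>The root is not a leaf, so a leaf before the end of the path would have two distinct
  neighbours there, against its degree being 1.\<close>

lemma leaf_on_path_to:
  assumes "v \<in> pverts (tgraph T)" "leaf T l \<in> set (pawalk_verts org (path_to v))"
  shows "v = leaf T l"
proof (rule ccontr)
  assume v: "v \<noteq> leaf T l"
  have path: "apath org (path_to v) v" by (rule apath_path_to) fact
  have "leaf T l \<noteq> org" using org_node by (auto simp: nodes_def)
  moreover obtain q r where qr: "path_to v = q @ r" "awalk org q (leaf T l)"
    using awalk_decomp[of org "path_to v" v "leaf T l"] path assms(2) by (auto simp: apath_def)
  ultimately have "q \<noteq> []" by (auto simp: awalk_Nil_iff)
  then obtain q' e where q: "q = q' @ [e]" by (metis rev_exhaust)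
  then have "e = (fst e, leaf T l)"
    using qr(2) by (auto simp: awalk_simps prod_eq_iff)
  then have "(fst e, leaf T l) \<in> set (path_to v)" using q qr(1) by simp
  \<comment> \<open>The path does not end at the leaf, so it continues, and not back to the vertex
    it came from.\<close>
  then obtain p1 z p2 where p: "path_to v = p1 @ (fst e, leaf T l) # (leaf T l, z) # p2" "fst e \<noteq> z"
    using apath_succ_decomp[OF path] v by metis
  have "set (path_to v) \<subseteq> parcs (tgraph T)"
    using path by (auto simp: apath_def)
  then have "(leaf T l, fst e) \<in> parcs (tgraph T)" "(leaf T l, z) \<in> parcs (tgraph T)"
    using p by (auto intro: arcs_symmetric)
  then show False using leaf_neighbour_unique p(2) by blast
qed

text \<open>If \<open>v\<close> is off the path to \<open>u\<close>, the arc extends that path.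
  Otherwise the portion from \<open>v\<close> to \<open>u\<close> must be the single reversed arc,
  by uniqueness of paths.\<close>

lemma path_to_internal_arc:
  assumes "(u, v) \<in> internal_arcs T"
  obtains "path_to v = path_to u @ [(u, v)]" | "path_to u = path_to v @ [(v, u)]"
proof -
  have uv: "(u, v) \<in> parcs (tgraph T)" "u \<in> pverts (tgraph T)" "v \<in> pverts (tgraph T)"
    using assms by (auto simp: internal_arcs_def nodes_def)
  have u: "apath org (path_to u) u" using uv by (simp add: apath_path_to)
  show thesis
  proof (cases "v \<in> set (pawalk_verts org (path_to u))")
    case False
    have "apath org (path_to u @ [(u, v)]) v"
      using u uv False by (auto simp: apath_def awalk_simps awalk_verts_append)
    then show thesis using that(1) tree_path_eqI by blast
  next
    case True
    obtain q r where qr: "path_to u = q @ r" "awalk org q v" "awalk v r u"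
      using awalk_decomp[of org "path_to u" u v] u True by (auto simp: apath_def)
    have "awlast org q = v" using qr(2) by auto
    then have "apath org q v" "apath v r u"
      using u qr(1) by (auto simp: apath_append_iff)
    moreover have "apath v [(v, u)] u"
      using uv arcs_symmetric no_loops' by (auto simp: apath_simps)
    ultimately have "path_to v = q" "r = [(v, u)]"
      using tree_path_eqI[of org q v] tree_path_eqI[of v r u] tree_path_eqI[of v "[(v, u)]" u]
      by simp_all
    then show thesis using that(2) qr(1) by blast
  qed
qed

text \<open>Induction on the length of the path from the root. The last vertex before a node is
  again a node, because a leaf cannot be passed through.\<close>

lemma node_induct [consumes 1, case_names org step]:
  assumes "v \<in> nodes T"
    and "P org"
    and "\<And>u v. (u, v) \<in> internal_arcs T \<Longrightarrow> path_to v = path_to u @ [(u, v)] \<Longrightarrow> P u \<Longrightarrow> P v"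
  shows "P v"
  using assms(1)
proof (induction "length (path_to v)" arbitrary: v)
  case 0
  then show ?case
    using apath_path_to[of v] assms(2) by (auto simp: apath_Nil_iff node_vert)
next
  case (Suc k)
  then have "path_to v \<noteq> []" by auto
  then obtain q e where qe: "path_to v = q @ [e]"
    by (metis rev_exhaust)
  have v: "apath org (q @ [e]) v" using apath_path_to[of v] Suc.prems qe by (simp add: node_vert)
  define u where "u = fst e"
  have "awlast org q = u" and e: "e = (u, v)" "e \<in> parcs (tgraph T)"
    using v by (auto simp: u_def apath_def awalk_simps)
  then have "apath org q u" using v by (auto simp: apath_append_iff)
  then have q: "path_to u = q" by (rule tree_path_eqI)
  have "u \<in> nodes T"
  proof -
    have "u \<noteq> leaf T l" for l
    proof
      assume "u = leaf T l"
      moreover have "u \<in> set (pawalk_verts org (path_to v))"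
        using v qe e by (auto simp: apath_def set_awalk_verts)
      ultimately have "v = leaf T l"
        using leaf_on_path_to Suc.prems node_vert by blast
      then show False using Suc.prems by (auto simp: nodes_def)
    qed
    then show ?thesis using e by (auto simp: nodes_def in_arcsD1)
  qed
  moreover have "k = length (path_to u)" using Suc.hyps(2) qe q by simp
  ultimately show ?case
    using assms(3)[of u v] Suc.hyps(1)[of u] Suc.prems e q qe
    by (auto simp: internal_arcs_def)
qed

lemma path_to_node_internal: "v \<in> nodes T \<Longrightarrow> set (path_to v) \<subseteq> internal_arcs T"
  by (induction rule: node_induct) (auto simp: path_to_org)

section \<open>Distances from the root, and the nodes of divergence\<close>

lemma tree_dist_org: "tree_dist T org org = 0"
  by (simp add: tree_dist_def path_to_org)

lemma tree_dist_invol: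
  assumes "v \<in> nodes T"
  shows "tree_dist T org (invol T v) = tree_dist T org v"
proof -
  have "sum_list (map (edge_length T \<circ> invol_arc) (path_to v)) =
      sum_list (map (edge_length T) (path_to v))"
    using path_to_node_internal[OF assms] internal_arc_length
    by (intro arg_cong[where f = sum_list] map_cong) auto
  then show ?thesis
    using assms by (simp add: tree_dist_def path_to_invol node_vert)
qed

text \<open>Both paths start at the root. Hence \<open>last\<close> in \<open>divergence\<close> is
  applied to a nonempty list.\<close>

lemma common_prefix_nonempty:
  assumes "u \<in> pverts (tgraph T)" "v \<in> pverts (tgraph T)"
  shows "longest_common_prefix (pawalk_verts org (path_to u)) (pawalk_verts org (path_to v)) \<noteq> []"
proof -
  have "hd (pawalk_verts org (path_to u)) = org" "hd (pawalk_verts org (path_to v)) = org"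
    using apath_path_to assms by (auto simp: apath_def)
  moreover have "pawalk_verts org (path_to u) \<noteq> []" "pawalk_verts org (path_to v) \<noteq> []" by auto
  ultimately show ?thesis
    by (cases "pawalk_verts org (path_to u)"; cases "pawalk_verts org (path_to v)") auto
qed

lemma divergence_on_paths:
  "divergence T org i j \<in> set (pawalk_verts org (path_to (leaf T (Unprimed i))))"
  "divergence T org i j \<in> set (pawalk_verts org (path_to (leaf T (Primed j))))"
proof -
  let ?xs = "pawalk_verts org (path_to (leaf T (Unprimed i)))"
  let ?ys = "pawalk_verts org (path_to (leaf T (Primed j)))"
  have "divergence T org i j \<in> set (longest_common_prefix ?xs ?ys)"
    by (simp add: divergence_def common_prefix_nonempty leaf_vert)
  then show "divergence T org i j \<in> set ?xs" "divergence T org i j \<in> set ?ys"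
    using set_mono_prefix[OF longest_common_prefix_prefix1[of ?xs ?ys]]
      set_mono_prefix[OF longest_common_prefix_prefix2[of ?xs ?ys]] by (simp_all add: subset_iff)
qed

text \<open>A leaf on both paths would be the end of both, although the two ends have different
  colours.\<close>

lemma divergence_node: "divergence T org i j \<in> nodes T"
proof -
  have "divergence T org i j \<noteq> leaf T l" for l
  proof
    assume "divergence T org i j = leaf T l"
    then have "leaf T (Unprimed i) = leaf T l" "leaf T (Primed j) = leaf T l"
      using divergence_on_paths[of i j] leaf_on_path_to leaf_vert by simp_all
    then have "Unprimed i = l" "Primed j = l"
      using inj_leaf by (auto simp: inj_eq)
    then show False by auto
  qed
  moreover have "divergence T org i j \<in> pverts (tgraph T)"
    using divergence_on_paths[of i j] apath_path_to[OF leaf_vert]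
    by (auto simp: apath_def)
  ultimately show ?thesis by (auto simp: nodes_def)
qed

text \<open>The involution carries the paths to \<open>i\<close> and \<open>j'\<close> to those to
  \<open>i'\<close> and \<open>j\<close>. Being injective on vertices, it commutes with taking the
  common prefix.\<close>

lemma divergence_swap: "divergence T org j i = invol T (divergence T org i j)"
proof -
  let ?xs = "pawalk_verts org (path_to (leaf T (Unprimed i)))"
  let ?ys = "pawalk_verts org (path_to (leaf T (Primed j)))"
  have swap: "pawalk_verts org (path_to (leaf T (swap_colour l))) =
      map (invol T) (pawalk_verts org (path_to (leaf T l)))" for l
  proof -
    have "path_to (leaf T (swap_colour l)) = map invol_arc (path_to (leaf T l))"
      using path_to_invol[OF leaf_vert] by (simp only: invol_leaf)
    then show ?thesis
      by (metis pawalk_verts_map invol_org)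
  qed
  have "set (pawalk_verts org (path_to (leaf T l))) \<subseteq> pverts (tgraph T)" for l
    using apath_path_to[OF leaf_vert] by (auto simp: apath_def)
  then have inj: "inj_on (invol T) (set ?xs \<union> set ?ys)"
    by (intro inj_on_subset[OF inj_on_invol]) auto
  have "divergence T org j i =
      last (longest_common_prefix (map (invol T) ?ys) (map (invol T) ?xs))"
    using swap[of "Unprimed i"] swap[of "Primed j"]
    by (simp only: divergence_def swap_colour.simps)
  also have "\<dots> = last (map (invol T) (longest_common_prefix ?xs ?ys))"
    by (subst longest_common_prefix_commute) (simp only: longest_common_prefix_map[OF inj])
  also have "\<dots> = invol T (divergence T org i j)"
    by (simp add: divergence_def last_map common_prefix_nonempty leaf_vert)
  finally show ?thesis .
qed

end

section \<open>The linear span of the type cone\<close>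

text \<open>Here \<open>h\<close> generalises the distance from the root. No monotonicity is imposed
  on it, which makes this set a linear space.\<close>

definition depth_space :: "('v, 'n::finite) metric_swap_tree \<Rightarrow> 'v \<Rightarrow> (real^'n^'n) set" where
  "depth_space T org = {(\<chi> i j. h (divergence T org i j) + X $ i + X $ j) | h X.
     h org = 0 \<and> (\<forall>v\<in>nodes T. h (invol T v) = h v)}"

lemma subspace_depth_space: "subspace (depth_space T org)"
proof (rule subspaceI)
  show "0 \<in> depth_space T org"
    unfolding depth_space_def
    by (rule CollectI, rule exI[of _ "\<lambda>_. 0"], rule exI[of _ 0]) (simp add: vec_eq_iff)
next
  fix A B assume "A \<in> depth_space T org" "B \<in> depth_space T org"
  then obtain h X h' X' where
    "A = (\<chi> i j. h (divergence T org i j) + X $ i + X $ j)"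
    "h org = 0" "\<forall>v\<in>nodes T. h (invol T v) = h v"
    "B = (\<chi> i j. h' (divergence T org i j) + X' $ i + X' $ j)"
    "h' org = 0" "\<forall>v\<in>nodes T. h' (invol T v) = h' v"
    by (auto simp: depth_space_def)
  then show "A + B \<in> depth_space T org"
    unfolding depth_space_def
    by (intro CollectI exI[of _ "\<lambda>v. h v + h' v"] exI[of _ "X + X'"]) (simp add: vec_eq_iff)
next
  fix c A assume "A \<in> depth_space T org"
  then obtain h X where
    "A = (\<chi> i j. h (divergence T org i j) + X $ i + X $ j)"
    "h org = 0" "\<forall>v\<in>nodes T. h (invol T v) = h v"
    by (auto simp: depth_space_def)
  then show "c *\<^sub>R A \<in> depth_space T org"
    unfolding depth_space_def
    by (intro CollectI exI[of _ "\<lambda>v. c * h v"] exI[of _ "c *\<^sub>R X"])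
      (simp add: vec_eq_iff algebra_simps)
qed

context rooted_symbic_tree
begin

lemma tree_matrix_plus_lineality_in_depth_space:
  assumes "B \<in> lineality"
  shows "tree_matrix T org + B \<in> depth_space T org"
proof -
  obtain X where "B = (\<chi> i j. X $ i + X $ j)"
    using assms by (auto simp: lineality_def)
  then show ?thesis
    unfolding depth_space_def
    \<comment> \<open>The distance from the root is itself an admissible depth function.\<close>
    by (intro CollectI exI[of _ "tree_dist T org"] exI[of _ X])
      (simp add: vec_eq_iff tree_matrix_def tree_dist_org tree_dist_invol)
qed

lemma type_cone_subset_depth_space: "type_cone T org \<subseteq> depth_space T org"
proof
  fix A assume "A \<in> type_cone T org"
  then obtain T' B where A: "A = tree_matrix T' org + B" "symbic_tree T'" "B \<in> lineality"
    and ct: "combinatorial_type T' = combinatorial_type T"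
    by (auto simp: type_cone_def)
  note eqs = same_combinatorial_type[OF ct]
  interpret T': rooted_symbic_tree T' org
    using A(2) org_vert invol_org by unfold_locales (simp_all add: eqs)
  \<comment> \<open>The depth space involves no edge lengths, only the combinatorial type.\<close>
  have "depth_space T' org = depth_space T org"
    by (simp add: depth_space_def divergence_def tree_path_def nodes_def eqs)
  then show "A \<in> depth_space T org"
    using T'.tree_matrix_plus_lineality_in_depth_space A by simp
qed

text \<open>
  A strictly increasing potential on the nodes is the distance from the root for suitable edge
  lengths, so that the cone is full-dimensional in the space of depth functions.
\<close>

lemma potential_in_type_cone:
  assumes h_org: "h org = 0" and h_invol: "\<And>v. v \<in> nodes T \<Longrightarrow> h (invol T v) = h v"
    and h_mono: "\<And>u v. (u, v) \<in> internal_arcs T \<Longrightarrow> path_to v = path_to u @ [(u, v)] \<Longrightarrow> h u < h v"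
    and B: "B \<in> lineality"
  shows "(\<chi> i j. h (divergence T org i j)) + B \<in> type_cone T org"
proof -
  define T' where "T' = T\<lparr>edge_length := \<lambda>(u, v). \<bar>h u - h v\<bar>\<rparr>"
  have [simp]: "tgraph T' = tgraph T" "leaf T' = leaf T" "invol T' = invol T"
    "edge_length T' = (\<lambda>(u, v). \<bar>h u - h v\<bar>)"
    by (simp_all add: T'_def)
  have ct: "combinatorial_type T' = combinatorial_type T"
    by (simp add: combinatorial_type_def swap_tree.defs)
  have [simp]: "internal_arcs T' = internal_arcs T" "splits T' = splits T"
    "fixed_verts T' = fixed_verts T" "tree_path T' = tree_path T"
    "divergence T' = divergence T"
    by (simp_all add: internal_arcs_def nodes_def splits_def side_def fixed_verts_def
        tree_path_def divergence_def fun_eq_iff)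
  \<comment> \<open>Every internal edge is the last step of the path to one of its ends, so
    \<open>h\<close> strictly increases along it in one direction. This makes the new lengths
    positive.\<close>
  have "h u \<noteq> h v" if "(u, v) \<in> internal_arcs T" for u v
  proof -
    have "(v, u) \<in> internal_arcs T"
      using that by (auto simp: internal_arcs_def intro: arcs_symmetric)
    with that show ?thesis
      using path_to_internal_arc[OF that] h_mono by (metis less_irrefl)
  qed
  moreover have "h (invol T u) = h u" "h (invol T v) = h v" if "(u, v) \<in> internal_arcs T" for u v
    using that h_invol by (auto simp: internal_arcs_def)
  ultimately have "\<forall>(u, v)\<in>internal_arcs T'. edge_length T' (u, v) > 0 \<and>
      edge_length T' (v, u) = edge_length T' (u, v) \<and>
      edge_length T' (invol T' u, invol T' v) = edge_length T' (u, v)"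
    by auto
  then have symbic': "symbic_tree T'"
    using symbic unfolding symbic_tree_def by simp
  \<comment> \<open>Along a path from the root the lengths are the increments of \<open>h\<close>,
    and they telescope.\<close>
  have "tree_dist T' org v = h v" if "v \<in> nodes T" for v
    using that
  proof (induction rule: node_induct)
    case org
    show ?case by (simp add: tree_dist_def path_to_org h_org)
  next
    case (step u v)
    then show ?case
      using h_mono[of u v] by (simp add: tree_dist_def)
  qed
  then have "tree_matrix T' org = (\<chi> i j. h (divergence T org i j))"
    by (simp add: tree_matrix_def divergence_node)
  then have "(\<chi> i j. h (divergence T org i j)) + B = tree_matrix T' org + B"
    by simp
  then show ?thesis
    unfolding type_cone_def using symbic' ct B by blast
qed

text \<open>Write \<open>h\<close> as the difference of \<open>d + h\<close> and \<open>d\<close>,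
  where \<open>d\<close> grows so steeply away from the root that both are strictly increasing
  potentials. The part \<open>B\<close> is attached to the first of them.\<close>

lemma depth_function_in_span:
  assumes h_org: "h org = 0" and h_invol: "\<And>v. v \<in> nodes T \<Longrightarrow> h (invol T v) = h v"
    and B: "B \<in> lineality"
  shows "(\<chi> i j. h (divergence T org i j)) + B \<in> span (type_cone T org)"
proof -
  \<comment> \<open>The slope \<open>K\<close> of \<open>d\<close> strictly exceeds every change of
    \<open>h\<close> along an internal edge; the summand 1 provides strictness.\<close>
  define K where "K = 1 + (\<Sum>(u, v)\<in>parcs (tgraph T). \<bar>h u - h v\<bar>)"
  define d where "d v = K * real (length (path_to v))" for v
  have K: "\<bar>h u - h v\<bar> < K" if "(u, v) \<in> internal_arcs T" for u v
  proof -
    have "(case (u, v) of (u, v) \<Rightarrow> \<bar>h u - h v\<bar>) \<le> (\<Sum>(u, v)\<in>parcs (tgraph T). \<bar>h u - h v\<bar>)"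
      using that pair_finite_arcs by (intro member_le_sum) (auto simp: internal_arcs_def)
    then show ?thesis by (simp add: K_def)
  qed
  have d_step: "d v = d u + K" if "path_to v = path_to u @ [(u, v)]" for u v
    unfolding d_def that by (simp add: algebra_simps)
  have d: "d org = 0" "v \<in> nodes T \<Longrightarrow> d (invol T v) = d v" for v
    by (simp_all add: d_def path_to_org path_to_invol node_vert)
  have "0 \<in> (lineality :: (real^'n^'n) set)"
    unfolding lineality_def by (rule CollectI, rule exI[of _ 0]) (simp add: vec_eq_iff)
  then have "(\<chi> i j. d (divergence T org i j)) + 0 \<in> type_cone T org"
    using K d d_step by (intro potential_in_type_cone) fastforce+
  moreover have "(\<chi> i j. d (divergence T org i j) + h (divergence T org i j)) + B
      \<in> type_cone T org"
  proof (rule potential_in_type_cone[where h = "\<lambda>v. d v + h v"])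
    fix u v assume "(u, v) \<in> internal_arcs T" "path_to v = path_to u @ [(u, v)]"
    then show "d u + h u < d v + h v" using K[of u v] d_step[of v u] by auto
  qed (use d h_org h_invol B in auto)
  ultimately have "((\<chi> i j. d (divergence T org i j) + h (divergence T org i j)) + B) -
      ((\<chi> i j. d (divergence T org i j)) + 0) \<in> span (type_cone T org)"
    by (intro span_diff span_base)
  moreover have "((\<chi> i j. d (divergence T org i j) + h (divergence T org i j)) + B) -
      ((\<chi> i j. d (divergence T org i j)) + 0) = (\<chi> i j. h (divergence T org i j)) + B"
    by (simp add: vec_eq_iff)
  ultimately show ?thesis by (simp only:)
qed

lemma span_type_cone: "span (type_cone T org) = depth_space T org"
proof
  show "span (type_cone T org) \<subseteq> depth_space T org"
    by (simp add: span_minimal type_cone_subset_depth_space subspace_depth_space)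
next
  show "depth_space T org \<subseteq> span (type_cone T org)"
  proof
    fix A assume "A \<in> depth_space T org"
    then obtain h X where
      A: "A = (\<chi> i j. h (divergence T org i j) + X $ i + X $ j)"
      and h: "h org = 0" "\<And>v. v \<in> nodes T \<Longrightarrow> h (invol T v) = h v"
      by (auto simp: depth_space_def)
    have "(\<chi> i j. X $ i + X $ j) \<in> lineality"
      by (auto simp: lineality_def)
    from depth_function_in_span[OF h this] show "A \<in> span (type_cone T org)"
      by (simp add: A plus_vec_def add.assoc)
  qed
qed

end

section \<open>Duality between projections and linear dependences\<close>

text \<open>A proper subspace has a nonzero orthogonal vector. For the image of \<open>W\<close>
  under the projection, the entries of such a vector form a nontrivial annihilating
  \<open>u\<close>.\<close>

lemma coord_proj_surj_iff:
  fixes W :: "(real^'n::finite^'n) set"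
  assumes "subspace W"
  shows "coord_proj S ` W = (S \<rightarrow>\<^sub>E UNIV) \<longleftrightarrow>
    (\<forall>u :: 'n \<times> 'n \<Rightarrow> real.
      (\<forall>A\<in>W. (\<Sum>s\<in>S. u s * A $ fst s $ snd s) = 0) \<longrightarrow> (\<forall>s\<in>S. u s = 0))"
    (is "?surj \<longleftrightarrow> ?triv")
proof
  assume ?surj
  show ?triv
  proof (intro allI impI)
    fix u :: "'n \<times> 'n \<Rightarrow> real"
    assume ann: "\<forall>A\<in>W. (\<Sum>s\<in>S. u s * A $ fst s $ snd s) = 0"
    \<comment> \<open>By surjectivity \<open>u\<close> is itself the projection of some matrix in
      \<open>W\<close>, hence orthogonal to itself.\<close>
    have "restrict u S \<in> coord_proj S ` W" using \<open>?surj\<close> by simp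
    then obtain A where "A \<in> W" and A: "restrict u S = coord_proj S A" by auto
    have "A $ fst s $ snd s = u s" if "s \<in> S" for s
      using fun_cong[OF A, of s] that by (simp add: coord_proj_def case_prod_beta)
    then have "(\<Sum>s\<in>S. u s * u s) = (\<Sum>s\<in>S. u s * A $ fst s $ snd s)"
      by simp
    then have "(\<Sum>s\<in>S. u s * u s) = 0" using ann \<open>A \<in> W\<close> by simp
    then show "\<forall>s\<in>S. u s = 0" by (simp add: sum_nonneg_eq_0_iff)
  qed
next
  assume triv: ?triv
  \<comment> \<open>The projection is modelled inside the matrix space, by zeroing the entries
    outside \<open>S\<close>, so that its inner product can be used.\<close>
  define E :: "real^'n^'n \<Rightarrow> real^'n^'n"
    where "E A = (\<chi> i j. if (i, j) \<in> S then A $ i $ j else 0)" for A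
  have lin: "linear E"
    by (rule linearI) (auto simp: E_def vec_eq_iff)
  have sub: "subspace (E ` W)" "subspace (range E)"
    using lin assms by (auto intro: linear_subspace_image)
  have inner_E: "y \<bullet> E A = (\<Sum>s\<in>S. y $ fst s $ snd s * A $ fst s $ snd s)" for y A
  proof -
    have "y \<bullet> E A = (\<Sum>s\<in>UNIV. if s \<in> S then y $ fst s $ snd s * A $ fst s $ snd s else 0)"
      by (simp add: inner_vec_def E_def sum.cartesian_product case_prod_beta
          UNIV_Times_UNIV[symmetric] if_distrib del: UNIV_Times_UNIV cong: if_cong)
    then show ?thesis by (simp add: sum.If_cases)
  qed
  have "E ` W = range E"
  proof (rule ccontr)
    assume "E ` W \<noteq> range E"
    then have "span (E ` W) \<subset> span (range E)"
      using sub by (simp add: span_eq_iff[THEN iffD2]) blast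
    then obtain y where y: "y \<noteq> 0" "y \<in> span (range E)" "\<And>z. z \<in> span (E ` W) \<Longrightarrow> orthogonal y z"
      using orthogonal_to_subspace_exists_gen by blast
    then have "y \<in> range E" using sub by (simp add: span_eq_iff[THEN iffD2])
    have "\<forall>A\<in>W. (\<Sum>s\<in>S. y $ fst s $ snd s * A $ fst s $ snd s) = 0"
      using y(3) by (auto simp: orthogonal_def inner_E[symmetric] intro: span_base)
    then have "\<forall>s\<in>S. y $ fst s $ snd s = 0"
      using triv[rule_format, of "\<lambda>s. y $ fst s $ snd s"] by blast
    \<comment> \<open>As a member of \<open>range E\<close>, \<open>y\<close> also vanishes outside
      \<open>S\<close>.\<close>
    then have "y = 0"
      using \<open>y \<in> range E\<close> by (fastforce simp: E_def vec_eq_iff)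
    with y(1) show False by simp
  qed
  show ?surj
  proof
    show "coord_proj S ` W \<subseteq> (S \<rightarrow>\<^sub>E UNIV)"
      by (auto simp: coord_proj_def)
  next
    show "(S \<rightarrow>\<^sub>E UNIV) \<subseteq> coord_proj S ` W"
    proof
      fix f :: "'n \<times> 'n \<Rightarrow> real" assume f: "f \<in> S \<rightarrow>\<^sub>E UNIV"
      have "E (\<chi> i j. f (i, j)) \<in> E ` W" using \<open>E ` W = range E\<close> by simp
      then obtain A where "A \<in> W" and A: "E (\<chi> i j. f (i, j)) = E A" by auto
      have A_eq: "A $ i $ j = f (i, j)" if "(i, j) \<in> S" for i j
        using arg_cong[OF A, of "\<lambda>M. M $ i $ j"] that by (simp add: E_def)
      have "f = coord_proj S A"
      proof (rule PiE_ext[OF f])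
        show "coord_proj S A \<in> S \<rightarrow>\<^sub>E UNIV" by (simp add: coord_proj_def)
      qed (use A_eq in \<open>auto simp: coord_proj_def\<close>)
      with \<open>A \<in> W\<close> show "f \<in> coord_proj S ` W" by blast
    qed
  qed
qed

text \<open>Applying \<open>\<phi>\<close> to a linear relation gives \<open>c\<close> times the sum
  of its coefficients. As \<open>c\<close> is nonzero, every linear relation is already an affine
  one.\<close>

lemma affine_independent_on_hyperplane_iff:
  fixes f :: "'a \<Rightarrow> 'b::real_vector" and \<phi> :: "'b \<Rightarrow> real"
  assumes "finite S" "inj_on f S" "linear \<phi>" "c \<noteq> 0" "\<And>s. s \<in> S \<Longrightarrow> \<phi> (f s) = c"
  shows "\<not> affine_dependent (f ` S) \<longleftrightarrow>
    (\<forall>u. (\<Sum>s\<in>S. u s *\<^sub>R f s) = 0 \<longrightarrow> (\<forall>s\<in>S. u s = 0))"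
proof -
  have sum_0: "(\<Sum>s\<in>S. u s) = 0" if "(\<Sum>s\<in>S. u s *\<^sub>R f s) = 0" for u
  proof -
    have "(\<Sum>s\<in>S. u s) * c = (\<Sum>s\<in>S. u s * \<phi> (f s))"
      using assms(5) by (simp add: sum_distrib_right)
    also have "\<dots> = \<phi> (\<Sum>s\<in>S. u s *\<^sub>R f s)"
      using assms(3) by (simp add: linear_sum linear_cmul)
    also have "\<dots> = 0" using that assms(3) by (simp add: linear_0)
    finally show ?thesis using assms(4) by simp
  qed
  have "affine_dependent (f ` S) \<longleftrightarrow>
      (\<exists>U. (\<Sum>s\<in>S. U (f s)) = 0 \<and> (\<exists>s\<in>S. U (f s) \<noteq> 0) \<and> (\<Sum>s\<in>S. U (f s) *\<^sub>R f s) = 0)"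
    using assms(1,2) by (simp add: affine_dependent_explicit_finite sum.reindex)
  also have "\<dots> \<longleftrightarrow> (\<exists>u. (\<Sum>s\<in>S. u s *\<^sub>R f s) = 0 \<and> (\<exists>s\<in>S. u s \<noteq> 0))"
  proof
    assume "\<exists>u. (\<Sum>s\<in>S. u s *\<^sub>R f s) = 0 \<and> (\<exists>s\<in>S. u s \<noteq> 0)"
    then obtain u where u: "(\<Sum>s\<in>S. u s *\<^sub>R f s) = 0" "\<exists>s\<in>S. u s \<noteq> 0" by blast
    \<comment> \<open>Affine dependence uses coefficients indexed by points, so \<open>u\<close> is
      transported along the inverse of \<open>f\<close>.\<close>
    have "(\<Sum>s\<in>S. u (the_inv_into S f (f s))) = 0 \<and> (\<exists>s\<in>S. u (the_inv_into S f (f s)) \<noteq> 0) \<and>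
        (\<Sum>s\<in>S. u (the_inv_into S f (f s)) *\<^sub>R f s) = 0"
      using u sum_0[OF u(1)] assms(2) by (simp add: the_inv_into_f_f)
    then show "\<exists>U. (\<Sum>s\<in>S. U (f s)) = 0 \<and> (\<exists>s\<in>S. U (f s) \<noteq> 0) \<and>
        (\<Sum>s\<in>S. U (f s) *\<^sub>R f s) = 0"
      by (intro exI[of _ "u \<circ> the_inv_into S f"]) simp
  qed auto
  finally show ?thesis by blast
qed

section \<open>The points of the Cayley embedding\<close>

lemma lookup_scaleR:
  fixes p :: "'k \<Rightarrow>\<^sub>0 'b::real_vector"
  shows "Poly_Mapping.lookup (r *\<^sub>R p) k = r *\<^sub>R Poly_Mapping.lookup p k"
proof -
  have "finite {k. r *\<^sub>R Poly_Mapping.lookup p k \<noteq> 0}"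
    by (rule finite_subset[OF _ finite_lookup[of p]]) auto
  then show ?thesis
    by (simp add: scaleR_poly_mapping_def Abs_poly_mapping_inverse)
qed

lemma linear_sum_components_fst: "linear (\<lambda>p :: (real^'n::finite) \<times> 'b::real_vector. \<Sum>k\<in>UNIV. fst p $ k)"
  by (rule linearI) (simp_all add: sum.distrib sum_distrib_left)

context rooted_symbic_tree
begin

abbreviation class_of :: "'n \<Rightarrow> 'n \<Rightarrow> 'v set" where
  "class_of i j \<equiv> {divergence T org i j, invol T (divergence T org i j)}"

lemma class_of_in_node_classes: "class_of i j \<in> node_classes T"
  unfolding node_classes_def using divergence_node by blast

lemma org_class_in_node_classes: "{org} \<in> node_classes T"
  unfolding node_classes_def using org_node invol_org by (intro CollectI exI[of _ org]) auto

text \<open>The vector determines \<open>i\<close> and \<open>j\<close> up to order, and exchanging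
  them moves the divergence node within its orbit. The node classes are these orbits, and orbits
  that meet coincide.\<close>

lemma edge_vec_in_class_config_iff:
  assumes "c \<in> node_classes T"
  shows "edge_vec i j \<in> class_config T org c \<longleftrightarrow> c = class_of i j"
proof -
  obtain v where v: "v \<in> nodes T" "c = {v, invol T v}"
    using assms by (auto simp: node_classes_def)
  have "edge_vec i j \<in> class_config T org c \<longleftrightarrow> divergence T org i j \<in> c \<or> divergence T org j i \<in> c"
    by (auto simp: class_config_def node_config_def edge_vec_eq_iff)
  also have "\<dots> \<longleftrightarrow> c = class_of i j"
  proof
    let ?d = "divergence T org i j"
    have "invol T (invol T ?d) = ?d" "invol T (invol T v) = v"
      using v(1) by (simp_all add: invol_invol node_vert divergence_node)
    moreover assume "?d \<in> c \<or> divergence T org j i \<in> c"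
    ultimately have "?d = v \<or> (?d = invol T v \<and> invol T ?d = v)"
      unfolding v(2) divergence_swap[of j i] by (metis insertE singletonD)
    then show "c = class_of i j"
      unfolding v(2) by (elim disjE conjE) (simp_all add: insert_commute)
  qed simp
  finally show ?thesis .
qed

text \<open>Only one class has \<open>edge_vec i j\<close> in its configuration, so the definite
  description has exactly one witness. The class \<open>{org}\<close> is the base index, with second
  component 0.\<close>

lemma cayley_point_eq:
  "cayley_point T org (i, j) =
    (edge_vec i j, if class_of i j = {org} then 0 else Poly_Mapping.single (class_of i j) 1)"
    (is "_ = ?p")
proof -
  have iff: "p \<in> tree_cayley T org \<and> fst p = edge_vec i j \<longleftrightarrow> p = ?p" for p
  proof -
    obtain x y where p: "p = (x, y)" by (cases p)
    have "p \<in> tree_cayley T org \<and> x = edge_vec i j \<longleftrightarrow> x = edge_vec i j \<and>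
        (edge_vec i j \<in> class_config T org {org} \<and> y = 0 \<or>
         (\<exists>c\<in>node_classes T - {{org}}. edge_vec i j \<in> class_config T org c \<and>
            y = Poly_Mapping.single c 1))"
      by (auto simp: p tree_cayley_def cayley_def)
    also have "\<dots> \<longleftrightarrow> x = edge_vec i j \<and>
        ({org} = class_of i j \<and> y = 0 \<or>
         (\<exists>c\<in>node_classes T - {{org}}. c = class_of i j \<and> y = Poly_Mapping.single c 1))"
      using edge_vec_in_class_config_iff org_class_in_node_classes
      by (metis (no_types, lifting) DiffD1)
    also have "\<dots> \<longleftrightarrow> p = ?p"
      using class_of_in_node_classes[of i j] by (auto simp: p)
    finally show ?thesis by (simp add: p)
  qed
  show ?thesis
    unfolding cayley_point_def prod.case iff by simp
qed

lemma real_cayley_point_eq: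
  "real_point (cayley_point T org (i, j)) = (axis i 1 + axis j 1,
    if class_of i j = {org} then 0 else Poly_Mapping.single (class_of i j) 1)"
proof -
  have "Poly_Mapping.map real_of_int (0 :: 'v set \<Rightarrow>\<^sub>0 int) = 0"
    by (metis map_single of_int_0 single_zero)
  then show ?thesis
    by (auto simp: cayley_point_eq real_point_def edge_vec_def vec_eq_iff axis_def)
qed

lemma lookup_cayley_point:
  "Poly_Mapping.lookup (snd (real_point (cayley_point T org (i, j)))) c =
    of_bool (class_of i j = c \<and> c \<noteq> {org})"
  by (auto simp: real_cayley_point_eq lookup_single when_def)

text \<open>Suitable matrices in the depth space read off each coordinate of the combination of
  points. Conversely, the entries of any such matrix are the values of one linear functional at the
  points.\<close>

lemma annihilates_depth_space_iff:
  fixes u :: "'n \<times> 'n \<Rightarrow> real"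
  shows "(\<forall>A\<in>depth_space T org. (\<Sum>s\<in>S. u s * A $ fst s $ snd s) = 0) \<longleftrightarrow>
    (\<Sum>s\<in>S. u s *\<^sub>R real_point (cayley_point T org s)) = 0"
proof
  assume ann: "\<forall>A\<in>depth_space T org. (\<Sum>s\<in>S. u s * A $ fst s $ snd s) = 0"
  have eq0: "(\<Sum>s\<in>S. u s * (h (divergence T org (fst s) (snd s)) + X $ fst s + X $ snd s)) = 0"
    if "h org = 0" "\<And>v. v \<in> nodes T \<Longrightarrow> h (invol T v) = h v" for h and X :: "real^'n"
  proof -
    have "(\<chi> i j. h (divergence T org i j) + X $ i + X $ j) \<in> depth_space T org"
      unfolding depth_space_def using that by blast
    with ann show ?thesis by fastforce
  qed
  show "(\<Sum>s\<in>S. u s *\<^sub>R real_point (cayley_point T org s)) = 0"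
  proof (rule prod_eqI)
    have "(\<Sum>s\<in>S. u s * fst (real_point (cayley_point T org s)) $ k) = 0" for k
    proof -
      \<comment> \<open>Taking \<open>h = 0\<close> and \<open>X\<close> the \<open>k\<close>-th
        unit vector extracts coordinate \<open>k\<close>.\<close>
      have "(\<Sum>s\<in>S. u s * fst (real_point (cayley_point T org s)) $ k) =
          (\<Sum>s\<in>S. u s * (0 + axis k 1 $ fst s + axis k 1 $ snd s))"
        by (intro sum.cong) (auto simp: real_cayley_point_eq axis_def)
      then show ?thesis using eq0[of "\<lambda>_. 0" "axis k 1"] by simp
    qed
    then show "fst (\<Sum>s\<in>S. u s *\<^sub>R real_point (cayley_point T org s)) = fst 0"
      by (simp add: fst_sum vec_eq_iff)
  next
    have "(\<Sum>s\<in>S. u s * Poly_Mapping.lookup (snd (real_point (cayley_point T org s))) c) = 0" for c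
    proof (cases "c = {org}")
      case False
      have "(\<Sum>s\<in>S. u s * Poly_Mapping.lookup (snd (real_point (cayley_point T org s))) c) =
          (\<Sum>s\<in>S. u s * of_bool (class_of (fst s) (snd s) = c))"
        using False by (intro sum.cong) (auto simp: lookup_cayley_point)
      \<comment> \<open>Here \<open>h\<close> is the indicator of the class \<open>c\<close>; it
        vanishes at \<open>org\<close> because \<open>c\<close> is not \<open>{org}\<close>.\<close>
      also have "\<dots> = 0"
        using False eq0[of "\<lambda>v. of_bool ({v, invol T v} = c)" 0]
        by (simp add: invol_org invol_invol node_vert insert_commute)
      finally show ?thesis .
    next
      case True
      then show ?thesis by (intro sum.neutral) (auto simp: lookup_cayley_point)
    qed
    then show "snd (\<Sum>s\<in>S. u s *\<^sub>R real_point (cayley_point T org s)) = snd 0"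
      by (intro poly_mapping_eqI) (simp add: snd_sum lookup_sum lookup_scaleR)
  qed
next
  assume dep: "(\<Sum>s\<in>S. u s *\<^sub>R real_point (cayley_point T org s)) = 0"
  show "\<forall>A\<in>depth_space T org. (\<Sum>s\<in>S. u s * A $ fst s $ snd s) = 0"
  proof
    fix A assume "A \<in> depth_space T org"
    then obtain h X where A: "A = (\<chi> i j. h (divergence T org i j) + X $ i + X $ j)"
      and h: "h org = 0" "\<forall>v\<in>nodes T. h (invol T v) = h v"
      by (auto simp: depth_space_def)
    \<comment> \<open>The classes that occur at some pair form a finite set, so the sum in
      \<open>\<psi>\<close> is finite. Since \<open>h\<close> is constant on node classes,
      \<open>g\<close> may use any representative.\<close>
    define C where "C = (\<lambda>(i, j). class_of i j) ` (UNIV :: ('n \<times> 'n) set)"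
    define g where "g c = h (SOME v. v \<in> c)" for c
    define \<psi> :: "(real^'n) \<times> ('v set \<Rightarrow>\<^sub>0 real) \<Rightarrow> real" where
      "\<psi> p = X \<bullet> fst p + (\<Sum>c\<in>C. g c * Poly_Mapping.lookup (snd p) c)" for p
    have lin: "linear \<psi>"
      by (rule linearI)
        (simp_all add: \<psi>_def inner_add_right lookup_add lookup_scaleR sum.distrib
          sum_distrib_left algebra_simps)
    have "\<psi> (real_point (cayley_point T org (i, j))) = A $ i $ j" for i j
    proof -
      have "(SOME v. v \<in> class_of i j) \<in> class_of i j" by (rule someI) blast
      then have g: "g (class_of i j) = h (divergence T org i j)"
        unfolding g_def using h divergence_node by fastforce
      have C: "finite C" "class_of i j \<in> C" by (auto simp: C_def)
      have "(\<Sum>c\<in>C. g c * Poly_Mapping.lookup (snd (real_point (cayley_point T org (i, j)))) c) =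
          (\<Sum>c\<in>C. if c = class_of i j then g c * of_bool (c \<noteq> {org}) else 0)"
        by (intro sum.cong) (auto simp: lookup_cayley_point)
      also have "\<dots> = g (class_of i j) * of_bool (class_of i j \<noteq> {org})"
        using C by (subst sum.delta) auto
      \<comment> \<open>For the class \<open>{org}\<close> the missing coordinate agrees with
        \<open>h org = 0\<close>.\<close>
      also have "\<dots> = h (divergence T org i j)"
        using g h(1) by auto
      finally show ?thesis
        by (simp add: \<psi>_def A real_cayley_point_eq inner_add_right inner_axis)
    qed
    then have "(\<Sum>s\<in>S. u s * A $ fst s $ snd s) =
        (\<Sum>s\<in>S. u s * \<psi> (real_point (cayley_point T org s)))"
      by (intro sum.cong) (auto simp: split_paired_all)
    also have "\<dots> = \<psi> (\<Sum>s\<in>S. u s *\<^sub>R real_point (cayley_point T org s))"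
      using lin by (simp add: linear_sum linear_cmul)
    also have "\<dots> = 0"
      using dep lin by (simp add: linear_0)
    finally show "(\<Sum>s\<in>S. u s * A $ fst s $ snd s) = 0" .
  qed
qed

lemma sum_fst_cayley_point: "(\<Sum>k\<in>UNIV. fst (real_point (cayley_point T org s)) $ k) = 2"
  by (cases s) (simp add: real_cayley_point_eq sum.distrib axis_def)

end

text \<open>The first component gives the unordered pair, and \<open>i \<le> j\<close> fixes its
  order. The lemma lies outside the locale because the labels must be linearly ordered here.\<close>

lemma inj_on_cayley_point:
  fixes T :: "('v, 'n::{finite,linorder}) metric_swap_tree"
  assumes "rooted_symbic_tree T org"
  shows "inj_on (\<lambda>s. real_point (cayley_point T org s)) ground_set"
proof (rule inj_onI)
  interpret rooted_symbic_tree T org by fact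
  fix s t :: "'n \<times> 'n"
  assume st: "s \<in> ground_set" "t \<in> ground_set"
    and eq: "real_point (cayley_point T org s) = real_point (cayley_point T org t)"
  obtain i j k l where ij: "s = (i, j)" "t = (k, l)" by (cases s; cases t)
  have "real_of_int (edge_vec i j $ m) = real_of_int (edge_vec k l $ m)" for m
    using arg_cong[OF eq, of "\<lambda>p. fst p $ m"] by (simp add: ij cayley_point_eq real_point_def)
  then have "edge_vec i j = edge_vec k l" by (simp add: vec_eq_iff)
  then show "s = t"
    using st by (auto simp: ij edge_vec_eq_iff ground_set_def)
qed

theorem proposition6p6:
  fixes T :: "('v, 'n::{finite,linorder}) metric_swap_tree" and org :: 'v
  assumes "symbic_tree T"
    and "org \<in> pverts (tgraph T)" and "invol T org = org"
  shows "(\<forall>(i, j) \<in> ground_set.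
            \<exists>!c. c \<in> node_classes T \<and> edge_vec i j \<in> class_config T org c) \<and>
         (\<forall>S \<subseteq> ground_set.
            matroid_indep T org S \<longleftrightarrow>
            \<not> affine_dependent ((\<lambda>s. real_point (cayley_point T org s)) ` S))"
proof -
  interpret rooted_symbic_tree T org
    using assms by unfold_locales
  have "\<exists>!c. c \<in> node_classes T \<and> edge_vec i j \<in> class_config T org c" for i j
    using class_of_in_node_classes[of i j] edge_vec_in_class_config_iff[of _ i j] by blast
  moreover have "matroid_indep T org S \<longleftrightarrow>
      \<not> affine_dependent ((\<lambda>s. real_point (cayley_point T org s)) ` S)" if S: "S \<subseteq> ground_set" for S
  proof -
    have inj: "inj_on (\<lambda>s. real_point (cayley_point T org s)) S"
      using inj_on_cayley_point[OF rooted_symbic_tree_axioms] S by (rule inj_on_subset)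
    have "matroid_indep T org S \<longleftrightarrow> coord_proj S ` depth_space T org = (S \<rightarrow>\<^sub>E UNIV)"
      using S by (simp add: matroid_indep_def span_type_cone)
    \<comment> \<open>The coefficient families that annihilate the depth space are exactly the
      linear relations among the points.\<close>
    also have "\<dots> \<longleftrightarrow> (\<forall>u. (\<Sum>s\<in>S. u s *\<^sub>R real_point (cayley_point T org s)) = 0 \<longrightarrow>
        (\<forall>s\<in>S. u s = 0))"
      by (simp add: coord_proj_surj_iff subspace_depth_space annihilates_depth_space_iff)
    \<comment> \<open>The hyperplane is given by the sum of the first \<open>n\<close> coordinates,
      with \<open>c = 2\<close>; injectivity turns the family indexed by \<open>S\<close> into a set
      of points.\<close>
    also have "\<dots> \<longleftrightarrow> \<not> affine_dependent ((\<lambda>s. real_point (cayley_point T org s)) ` S)"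
      by (rule affine_independent_on_hyperplane_iff[OF _ inj linear_sum_components_fst _ sum_fst_cayley_point,
            symmetric]) simp_all
    finally show ?thesis .
  qed
  ultimately show ?thesis by blast
qed

end
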